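(* Let $n,i,j,p$ be integers with $0<i<j\le n/2$, $\gcd(n,i,j)=1$ and $p\ge1$, such that either $i=1$ or neither $i$ nor $j$ is a unit in $\mathbb{Z}_n$. If $p\ge2$ and $H'=\{\pm1\}$, then $$\operatorname{Det}(C_n(i_\div p,j))=1,\quad \operatorname{Dist}(C_n(i_\div p,j))=2,\quad \rho(C_n(i_\div p,j))=1.$$ Otherwise, $\operatorname{Det}(C_n(i_\div p,j))=\operatorname{Dist}(C_n(i_\div p,j))=\rho(C_n(i_\div p,j))=2$.
   Context: The subdivided circulant graph $C_n(i_\div p,j)$ has vertices $u_a$ ($a\in\mathbb{Z}_n$) and $v_a^r$ ($a\in\mathbb{Z}_n$, $1\le r\le p$), with edges $u_au_{a+j}$ for all $a\in\mathbb{Z}_n$, and, for each $a\in\mathbb{Z}_n$, the edges of the path $(u_a,v_a^1,v_a^2,\dots,v_a^p,u_{a+i})$. $U(n)$ is the group of units of $\mathbb{Z}_n$, and $H'=\{t\in U(n): t\{\pm i\}=\{\pm i\}\text{ and }t\{\pm j\}=\{\pm j\}\}$. A determining set of a graph $G$ is a vertex subset $W$ such that only the identity automorphism fixes every vertex of $W$; $\operatorname{Det}(G)$ is the minimum size of a determining set. A $d$-distinguishing coloring is an assignment of $d$ colors to the vertices such that only the identity automorphism preserves every color class setwise; $\operatorname{Dist}(G)$ is the minimum such $d$. If $\operatorname{Dist}(G)=2$, the cost $\rho(G)$ is the minimum size of a color class over all 2-distinguishing colorings of $G$. *)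

theory Defs
  imports "HOL-Number_Theory.Residues" "HOL-Combinatorics.Permutations"
begin

section \<open>Finite simple graphs and symmetry breaking\<close>

text \<open>Edges are two-element sets of vertices. All notions below are meant for finite graphs only;
  in particular they use the cardinality \<^const>\<open>card\<close>, which is 0 on infinite sets.\<close>

record 'v sgraph =
  verts :: "'v set"
  edges :: "'v set set"

definition simple_graph :: "'v sgraph \<Rightarrow> bool" where
  "simple_graph G \<longleftrightarrow> finite (verts G) \<and> (\<forall>e \<in> edges G. e \<subseteq> verts G \<and> card e = 2)"

text \<open>By \<^const>\<open>permutes\<close>, an automorphism leaves everything outside the vertex set alone, so the
  identity automorphism is \<^const>\<open>id\<close>.\<close>

definition automorphisms :: "'v sgraph \<Rightarrow> ('v \<Rightarrow> 'v) set" where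
  "automorphisms G = {f. f permutes verts G \<and>
     (\<forall>x \<in> verts G. \<forall>y \<in> verts G. {f x, f y} \<in> edges G \<longleftrightarrow> {x, y} \<in> edges G)}"

definition determining_set :: "'v sgraph \<Rightarrow> 'v set \<Rightarrow> bool" where
  "determining_set G W \<longleftrightarrow>
     W \<subseteq> verts G \<and> (\<forall>f \<in> automorphisms G. (\<forall>w \<in> W. f w = w) \<longrightarrow> f = id)"

definition Det :: "'v sgraph \<Rightarrow> nat" where
  "Det G = (LEAST k. \<exists>W. determining_set G W \<and> card W = k)"

definition color_class :: "'v sgraph \<Rightarrow> ('v \<Rightarrow> nat) \<Rightarrow> nat \<Rightarrow> 'v set" where
  "color_class G c k = {x \<in> verts G. c x = k}"

text \<open>A coloring with \<open>d\<close> colors need not use all of them. This does not affect the minimal number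
  of colors, and if that number is \<open>d\<close>, then a \<open>d\<close>-distinguishing coloring uses every color.\<close>

definition distinguishing_coloring :: "'v sgraph \<Rightarrow> nat \<Rightarrow> ('v \<Rightarrow> nat) \<Rightarrow> bool" where
  "distinguishing_coloring G d c \<longleftrightarrow>
     (\<forall>x \<in> verts G. c x < d) \<and>
     (\<forall>f \<in> automorphisms G. (\<forall>k < d. f ` color_class G c k = color_class G c k) \<longrightarrow> f = id)"

definition Dist :: "'v sgraph \<Rightarrow> nat" where
  "Dist G = (LEAST d. \<exists>c. distinguishing_coloring G d c)"

text \<open>Only meaningful if \<^term>\<open>Dist G = 2\<close>.\<close>

definition cost :: "'v sgraph \<Rightarrow> nat" where
  "cost G = (LEAST m. \<exists>c k. distinguishing_coloring G 2 c \<and> k < 2 \<and> card (color_class G c k) = m)"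


section \<open>Subdivided circulant graphs\<close>

text \<open>Elements of \<open>\<int>\<^sub>n\<close> are represented by their residues in \<^term>\<open>{0..<n}\<close>.\<close>

datatype sc_vertex = U int | V int nat

definition path_edges :: "'v list \<Rightarrow> 'v set set" where
  "path_edges xs = {{xs ! k, xs ! Suc k} | k. Suc k < length xs}"

definition subdivision_path :: "int \<Rightarrow> int \<Rightarrow> nat \<Rightarrow> int \<Rightarrow> sc_vertex list" where
  "subdivision_path n i p a = U a # map (V a) [1..<Suc p] @ [U ((a + i) mod n)]"

definition subdivided_circulant :: "int \<Rightarrow> int \<Rightarrow> nat \<Rightarrow> int \<Rightarrow> sc_vertex sgraph" where
  "subdivided_circulant n i p j =
     \<lparr>verts = U ` {0..<n} \<union> {V a r | a r. a \<in> {0..<n} \<and> r \<in> {1..p}},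
      edges = {{U a, U ((a + j) mod n)} | a. a \<in> {0..<n}}
            \<union> (\<Union>a \<in> {0..<n}. path_edges (subdivision_path n i p a))\<rparr>"

lemma simple_graph_subdivided_circulant:
  assumes "0 < j" "j < n" "1 \<le> p"
  shows "simple_graph (subdivided_circulant n i p j)"
proof -
  have fin: "finite (verts (subdivided_circulant n i p j))"
  proof -
    have "{V a r | a r. a \<in> {0..<n} \<and> r \<in> {1..p}} = (\<lambda>(a, r). V a r) ` ({0..<n} \<times> {1..p})"
      by auto
    then show ?thesis
      by (simp add: subdivided_circulant_def)
  qed
  have ne: "(a + j) mod n \<noteq> a" for a
  proof
    assume "(a + j) mod n = a"
    then have "n dvd j"
      using mod_eq_dvd_iff[of "a + j" n a] by (metis add_diff_cancel_left' mod_mod_trivial)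
    then show False
      using assms zdvd_imp_le by fastforce
  qed
  have path: "e \<subseteq> verts (subdivided_circulant n i p j) \<and> card e = 2"
    if a: "a \<in> {0..<n}" and e0: "e \<in> path_edges (subdivision_path n i p a)" for a e
  proof -
    let ?xs = "subdivision_path n i p a"
    obtain k where k: "Suc k < length ?xs" and e: "e = {?xs ! k, ?xs ! Suc k}"
      using e0 unfolding path_edges_def by blast
    have len: "length ?xs = p + 2"
      by (simp add: subdivision_path_def)
    have nth: "?xs ! m = (if m = 0 then U a else if m \<le> p then V a m else U ((a + i) mod n))"
      if "m < p + 2" for m
      using that by (cases m) (auto simp: subdivision_path_def nth_append simp del: upt_Suc)
    show ?thesis
      using k a assms by (auto simp: e len nth subdivided_circulant_def card_2_iff)
  qed
  show ?thesis
    unfolding simple_graph_def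
  proof (intro conjI fin ballI)
    fix e assume "e \<in> edges (subdivided_circulant n i p j)"
    then consider a where "a \<in> {0..<n}" "e = {U a, U ((a + j) mod n)}"
      | a where "a \<in> {0..<n}" "e \<in> path_edges (subdivision_path n i p a)"
      by (auto simp: subdivided_circulant_def)
    then have "e \<subseteq> verts (subdivided_circulant n i p j) \<and> card e = 2"
    proof cases
      case (1 a)
      have "U a \<noteq> U ((a + j) mod n)"
        using ne[of a] by simp
      then show ?thesis
        using 1 by (auto simp: subdivided_circulant_def)
    qed (use path in blast)
    then show "e \<subseteq> verts (subdivided_circulant n i p j)" "card e = 2"
      by auto
  qed
qed


section \<open>Units of \<open>\<int>\<^sub>n\<close> respecting the connection set\<close>

definition pm :: "int \<Rightarrow> int \<Rightarrow> int set" where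
  "pm n x = {x mod n, (- x) mod n}"

definition connection_units :: "int \<Rightarrow> int \<Rightarrow> int \<Rightarrow> int set" where
  "connection_units n i j = {t \<in> Units (residue_ring n).
     (\<lambda>x. t * x mod n) ` pm n i = pm n i \<and> (\<lambda>x. t * x mod n) ` pm n j = pm n j}"

end

theory Submission
  imports Defs
begin

text \<open>
  Call the vertices \<open>U a\<close> hubs. Every hub has at least three neighbours and every subdivision vertex has
  two, so an automorphism permutes the hubs, and it maps the path between two hubs onto another such
  path. It is therefore determined by a bijection \<open>g\<close> of \<open>\<int>\<^sub>n\<close> that preserves the differences
  \<open>\<plusminus>i\<close> and the differences \<open>\<plusminus>j\<close>, each kind separately.

  Such a \<open>g\<close> is affine, \<open>g x = b + t x\<close> (lemma \<open>affine_of_edge_preserving\<close>). Write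
  \<open>g (x + i) = g x + s x * i\<close> and \<open>g (x + j) = g x + d x * j\<close> with signs \<open>s x\<close> and \<open>d x\<close>. The sign \<open>s\<close>
  is constant along translates by \<open>i\<close>, since a change of sign would give \<open>g (x + 2 i) = g x\<close>; likewise
  for \<open>d\<close> and \<open>j\<close>. Computing \<open>g (x + i + j)\<close> in two ways gives
  \<open>(s x - s (x + j)) i = (d x - d (x + i)) j\<close>, where both coefficients lie in \<open>{0, 2, -2}\<close>; neither
  sign can change unless \<open>2 i = \<plusminus>2 j\<close> (if \<open>2 j = 0\<close>, take \<open>d\<close> to be 1 throughout). Now
  \<open>2 i = 2 j\<close> is excluded by \<open>i < j \<le> n/2\<close>, and \<open>2 i = -2 j\<close> means \<open>n = 2 (i + j)\<close>,
  which together with \<open>gcd (n, i, j) = 1\<close> forces \<open>i\<close> or \<open>j\<close> to be a unit.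
  This is where the assumption on units enters: if \<open>i = 1\<close> instead, then the translates by \<open>i\<close>
  already exhaust \<open>\<int>\<^sub>n\<close>. Because \<open>i\<close> and \<open>j\<close> generate \<open>\<int>\<^sub>n\<close>, constant signs make \<open>g\<close> affine, and the
  multiplier \<open>t\<close> maps \<open>i\<close> to \<open>\<plusminus>i\<close> and \<open>j\<close> to \<open>\<plusminus>j\<close>, so it lies in \<open>H'\<close>. Conversely each \<open>t\<close> in \<open>H'\<close>
  and each \<open>b\<close> define an automorphism (lemma \<open>affine_automorphism\<close>).

  The three invariants are then read off from one kind of set: \<open>W\<close> is rigid if only the identity maps
  \<open>W\<close> onto itself. Rigid sets are determining sets and also are colour classes of distinguishing
  2-colourings, and each colour class of such a colouring is a determining set. Hence a rigid set that is
  a smallest determining set yields the determining number and the cost at once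
  (lemma \<open>Dist_cost_of_rigid_set\<close>).

  The reflection \<open>x \<mapsto> 2 a - x\<close> fixes the hub \<open>a\<close>, so neither the empty set nor a single hub is
  determining. If \<open>p \<ge> 2\<close> and \<open>H' = {1, -1}\<close>, then the first subdivision vertex of a path is rigid: an
  automorphism fixing it cannot reverse the path. Otherwise no single vertex is determining: for \<open>p = 1\<close>
  the reflection \<open>x \<mapsto> 2 a + i - x\<close> fixes the midpoint of a path, and for \<open>H' \<noteq> {1, -1}\<close> there is a
  nontrivial \<open>t \<in> H'\<close> with \<open>t i = i\<close>, which fixes a whole path pointwise. In every case
  the hub \<open>0\<close> together with the first subdivision vertex after the hub \<open>-j\<close> is rigid
  (lemma \<open>rigid_hub_and_inner\<close>).
\<close>


section \<open>Rigid vertex sets\<close>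

text \<open>This differs from a determining set in that \<open>f\<close> may permute the elements of \<open>W\<close>: a colouring
  only notices whether its classes are preserved as sets.\<close>

definition rigid_set :: "'v sgraph \<Rightarrow> 'v set \<Rightarrow> bool" where
  "rigid_set G W \<longleftrightarrow> W \<subseteq> verts G \<and> (\<forall>f \<in> automorphisms G. f ` W = W \<longrightarrow> f = id)"

lemma automorphism_permutes: "f \<in> automorphisms G \<Longrightarrow> f permutes verts G"
  by (simp add: automorphisms_def)

lemma rigid_set_imp_determining_set: "rigid_set G W \<Longrightarrow> determining_set G W"
  by (simp add: rigid_set_def determining_set_def)

lemma Det_le_card: "determining_set G W \<Longrightarrow> Det G \<le> card W"
  unfolding Det_def by (intro Least_le) blast

text \<open>With two colours, the other class is the complement of this one, so an automorphism fixing
  one class pointwise preserves both classes.\<close>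

lemma determining_color_class:
  assumes c: "distinguishing_coloring G 2 c" and k: "k < 2"
  shows "determining_set G (color_class G c k)"
  unfolding determining_set_def
proof (intro conjI ballI impI)
  show "color_class G c k \<subseteq> verts G"
    by (auto simp: color_class_def)
  fix f assume f: "f \<in> automorphisms G" and fix_k: "\<forall>w \<in> color_class G c k. f w = w"
  have "f ` color_class G c l = color_class G c l" if "l < 2" for l
  proof (cases "l = k")
    case False
    then have "x = k \<longleftrightarrow> x \<noteq> l" if "x < 2" for x
      using that k \<open>l < 2\<close> by linarith
    then have other: "color_class G c l = verts G - color_class G c k"
      using c by (auto simp: color_class_def distinguishing_coloring_def)
    have "f ` (verts G - color_class G c k) = f ` verts G - f ` color_class G c k"
      using permutes_inj[OF automorphism_permutes[OF f]] by (rule image_set_diff)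
    then show ?thesis
      using fix_k permutes_image[OF automorphism_permutes[OF f]] by (simp add: other)
  qed (use fix_k in simp)
  then show "f = id"
    using c f by (auto simp: distinguishing_coloring_def)
qed

text \<open>Colouring \<open>W\<close> against its complement shows \<open>Dist G \<le> 2\<close> and \<open>cost G \<le> card W\<close>. With at most one
  colour every automorphism preserves the colouring, which would make the empty set determining. No
  cost below \<open>Det G\<close> is possible because colour classes are determining sets.\<close>

lemma Dist_cost_of_rigid_set:
  assumes W: "rigid_set G W" and card: "card W = Det G" and pos: "0 < Det G"
  shows "Dist G = 2 \<and> cost G = Det G"
proof -
  define c where "c x = (if x \<in> W then 1 else 0 :: nat)" for x
  have class_1: "color_class G c 1 = W"
    using W by (auto simp: color_class_def c_def rigid_set_def)
  have c: "distinguishing_coloring G 2 c"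
    unfolding distinguishing_coloring_def
  proof (intro conjI ballI impI)
    fix f assume "f \<in> automorphisms G" "\<forall>k<2. f ` color_class G c k = color_class G c k"
    then show "f = id"
      using W class_1 by (auto simp: rigid_set_def)
  qed (simp add: c_def)
  have "2 \<le> d" if d: "distinguishing_coloring G d c'" for d c'
  proof (rule ccontr)
    assume "\<not> 2 \<le> d"
    have "color_class G c' k = verts G" if "k < d" for k
      using d that \<open>\<not> 2 \<le> d\<close> by (force simp: color_class_def distinguishing_coloring_def)
    then have "f = id" if "f \<in> automorphisms G" for f
      using d that permutes_image[OF automorphism_permutes[OF that]]
      by (simp add: distinguishing_coloring_def)
    then have "determining_set G {}"
      by (simp add: determining_set_def)
    then show False
      using Det_le_card[of G "{}"] pos by simp
  qed
  then have "Dist G = 2"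
    unfolding Dist_def using c by (intro Least_equality) blast+
  moreover have "cost G = Det G"
    unfolding cost_def
  proof (rule Least_equality)
    show "\<exists>c k. distinguishing_coloring G 2 c \<and> k < 2 \<and> card (color_class G c k) = Det G"
      using c class_1 card by (intro exI[of _ c] exI[of _ 1]) simp
  qed (use determining_color_class Det_le_card in blast)
  ultimately show ?thesis ..
qed

text \<open>An injective map of a finite graph into itself that sends edges to edges permutes the finite
  set of edges, so it also sends non-edges to non-edges.\<close>

lemma automorphism_of_edge_preserving:
  assumes G: "simple_graph G"
    and inj: "inj_on h (verts G)" and verts: "h ` verts G \<subseteq> verts G"
    and edge: "\<And>e. e \<in> edges G \<Longrightarrow> h ` e \<in> edges G"
  shows "(\<lambda>x. if x \<in> verts G then h x else x) \<in> automorphisms G"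
proof -
  let ?f = "\<lambda>x. if x \<in> verts G then h x else x"
  have fin: "finite (verts G)" and sub: "edges G \<subseteq> Pow (verts G)"
    using G by (auto simp: simple_graph_def)
  have "h ` verts G = verts G"
    using endo_inj_surj[OF fin verts inj] .
  then have "bij_betw ?f (verts G) (verts G)"
    using inj by (auto simp: bij_betw_def inj_on_def)
  then have "?f permutes verts G"
    by (rule bij_imp_permutes) simp
  moreover have onto: "(`) h ` edges G = edges G"
  proof (rule endo_inj_surj)
    show "finite (edges G)"
      using fin sub finite_subset by blast
    show "inj_on ((`) h) (edges G)"
      using sub inj inj_on_image_Pow inj_on_subset by blast
  qed (use edge in blast)
  have "{h x, h y} \<in> edges G \<longleftrightarrow> {x, y} \<in> edges G" if xy: "x \<in> verts G" "y \<in> verts G" for x y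
  proof
    assume "{h x, h y} \<in> edges G"
    then obtain e where e: "e \<in> edges G" "h ` {x, y} = h ` e"
      using onto by (metis (no_types, lifting) image_empty image_iff image_insert)
    then have "{x, y} = e"
      using xy sub inj inj_on_image_eq_iff[of h "verts G" "{x, y}" e] by auto
    then show "{x, y} \<in> edges G"
      using e by simp
  qed (use edge[of "{x, y}"] in simp)
  ultimately show ?thesis
    by (auto simp: automorphisms_def)
qed


section \<open>Integer functions with prescribed increments\<close>

lemma int_translation_invariant:
  fixes s :: "int \<Rightarrow> 'a" and m k x :: int
  assumes "\<And>x. s (x + m) = s x"
  shows "s (x + k * m) = s x"
proof (induction k rule: int_induct[where k = 0])
  case (step1 k)
  then show ?case
    using assms[of "x + k * m"] by (simp add: algebra_simps)
next
  case (step2 k)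
  then show ?case
    using assms[of "x + (k - 1) * m"] by (simp add: algebra_simps)
qed simp

lemma progression_increments:
  fixes g :: "int \<Rightarrow> int" and n m c x k :: int
  assumes step: "\<And>k. n dvd g (x + k * m + m) - g (x + k * m) - c"
  shows "n dvd g (x + k * m) - g x - k * c"
proof (induction k rule: int_induct[where k = 0])
  case (step1 k)
  have "n dvd g (x + (k + 1) * m) - g (x + k * m) - c"
    using step[of k] by (simp add: algebra_simps)
  then show ?case
    using step1 unfolding dvd_def by Groebner_Basis.algebra
next
  case (step2 k)
  have "n dvd g (x + k * m) - g (x + (k - 1) * m) - c"
    using step[of "k - 1"] by (simp add: algebra_simps)
  then show ?case
    using step2 unfolding dvd_def by Groebner_Basis.algebra
qed simp


section \<open>Maps preserving both kinds of differences are affine\<close>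

text \<open>Elements of \<open>\<int>\<^sub>n\<close> are represented by arbitrary integers in what follows, and equality in \<open>\<int>\<^sub>n\<close> is
  expressed as divisibility of the difference by \<open>n\<close>.\<close>

locale circulant_parameters =
  fixes n i j :: int and p :: nat
  assumes i_pos: "0 < i" and i_less_j: "i < j" and j_le_half: "2 * j \<le> n"
    and gcd_one: "gcd n (gcd i j) = 1" and p_pos: "1 \<le> p"
begin

lemma n_ge_4: "4 \<le> n"
  using i_pos i_less_j j_le_half by linarith

lemma not_dvd_small:
  fixes x :: int
  assumes "0 < x" "x < n"
  shows "\<not> n dvd x"
  using assms zdvd_not_zless by blast

lemma not_dvd_i: "\<not> n dvd i" and not_dvd_2i: "\<not> n dvd 2 * i"
  using not_dvd_small[of i] not_dvd_small[of "2 * i"] i_pos i_less_j j_le_half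
  by auto

lemma not_dvd_2i_minus_2j: "\<not> n dvd 2 * i - 2 * j"
proof
  assume "n dvd 2 * i - 2 * j"
  then have "n dvd 2 * j - 2 * i"
    by (subst dvd_diff_commute)
  then show False
    using not_dvd_small[of "2 * j - 2 * i"] i_pos i_less_j j_le_half by auto
qed

text \<open>Since \<open>gcd (n, i, j) = 1\<close>, the elements \<open>i\<close> and \<open>j\<close> generate \<open>\<int>\<^sub>n\<close>.\<close>

lemma bezout:
  obtains \<alpha> \<beta> where "n dvd 1 - \<alpha> * i - \<beta> * j"
proof -
  obtain u v where uv: "u * n + v * gcd i j = 1"
    using bezout_int[of n "gcd i j"] gcd_one by auto
  obtain a b where ab: "a * i + b * j = gcd i j"
    using bezout_int[of i j] by blast
  have "1 - (v * a) * i - (v * b) * j = 1 - v * (a * i + b * j)"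
    by (simp add: algebra_simps)
  also have "\<dots> = n * u"
    using uv ab by (simp add: algebra_simps)
  finally have "1 - (v * a) * i - (v * b) * j = n * u" .
  then show thesis
    using that by (metis dvd_triv_left)
qed

text \<open>If the sign changed between \<open>x\<close> and \<open>x + m\<close>, the walk would step back:
  \<open>g (x + 2 m) = g x\<close>, which injectivity forbids.\<close>

lemma sign_constant_along_cycle:
  fixes g s :: "int \<Rightarrow> int" and m :: int
  assumes m: "\<not> n dvd 2 * m"
    and inj: "\<And>x y. n dvd g x - g y \<Longrightarrow> n dvd x - y"
    and step: "\<And>x. n dvd g (x + m) - g x - s x * m"
    and s: "\<And>x. s x = 1 \<or> s x = - 1"
  shows "s (x + m) = s x"
proof (rule ccontr)
  assume "s (x + m) \<noteq> s x"
  then have "s (x + m) = - s x"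
    using s[of x] s[of "x + m"] by auto
  then have "n dvd g (x + m + m) - g x"
    using step[of x] step[of "x + m"] unfolding dvd_def by Groebner_Basis.algebra
  then have "n dvd 2 * m"
    using inj[of "x + m + m" x] by simp
  then show False
    using m by simp
qed

text \<open>The square \<open>x, x + i, x + i + j, x + j\<close> links the sign \<open>s\<close> of \<open>i\<close>-steps with the sign \<open>d\<close> of
  \<open>j\<close>-steps. As \<open>2 i \<noteq> \<plusminus>2 j\<close>, both signs are the same on opposite sides of the square, so they are
  constant on the integer combinations of \<open>i\<close> and \<open>j\<close>.\<close>

lemma affine_of_square_condition:
  fixes g :: "int \<Rightarrow> int"
  assumes ij: "\<not> n dvd 2 * i + 2 * j"
    and periodic: "\<And>x y. n dvd x - y \<Longrightarrow> n dvd g x - g y"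
    and inj: "\<And>x y. n dvd g x - g y \<Longrightarrow> n dvd x - y"
    and gi: "\<And>x. n dvd g (x + i) - g x - i \<or> n dvd g (x + i) - g x + i"
    and gj: "\<And>x. n dvd g (x + j) - g x - j \<or> n dvd g (x + j) - g x + j"
  shows "\<exists>t. \<forall>x. n dvd g x - g 0 - t * x"
proof -
  define s where "s x = (if n dvd g (x + i) - g x - i then 1 else - 1 :: int)" for x
  define d where "d x = (if n dvd g (x + j) - g x - j then 1 else - 1 :: int)" for x
  have s: "n dvd g (x + i) - g x - s x * i" "s x = 1 \<or> s x = - 1" for x
    using gi[of x] by (auto simp: s_def)
  have d: "n dvd g (x + j) - g x - d x * j" "d x = 1 \<or> d x = - 1" for x
    using gj[of x] by (auto simp: d_def)
  \<comment> \<open>If \<open>2 j = 0\<close>, then \<open>j = - j\<close> and the definition of \<open>d\<close> picks the sign 1 everywhere.\<close>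
  have d_one: "d x = 1" if "n dvd 2 * j" for x
  proof -
    have "n dvd g (x + j) - g x - j"
      using gj[of x]
    proof
      assume "n dvd g (x + j) - g x + j"
      then show ?thesis
        using that unfolding dvd_def by Groebner_Basis.algebra
    qed
    then show ?thesis
      by (simp add: d_def)
  qed
  have s_i: "s (x + i) = s x" for x
    using not_dvd_2i inj s by (rule sign_constant_along_cycle)
  have d_j: "d (x + j) = d x" for x
  proof (cases "n dvd 2 * j")
    case False
    then show ?thesis
        using inj d by (rule sign_constant_along_cycle)
  qed (simp add: d_one)
  have square: "n dvd (s x - s (x + j)) * i - (d x - d (x + i)) * j" for x
  proof -
    have "n dvd g (x + i + j) - g (x + j) - s (x + j) * i"
      using s(1)[of "x + j"] by (simp add: algebra_simps)
    then show ?thesis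
      using s(1)[of x] d(1)[of x] d(1)[of "x + i"] unfolding dvd_def by Groebner_Basis.algebra
  qed
  have sd: "s (x + j) = s x \<and> d (x + i) = d x" for x
  proof -
    have "n dvd 2 * i + 2 * j \<longleftrightarrow> n dvd - (2 * i) - 2 * j" "n dvd 2 * i - 2 * j \<longleftrightarrow> n dvd 2 * j - 2 * i"
      by (metis dvd_minus_iff minus_add_distrib uminus_add_conv_diff add.commute minus_diff_eq)+
    then show ?thesis
      using square[of x] s(2)[of x] s(2)[of "x + j"] d(2)[of x] d(2)[of "x + i"]
        d_one[of x] d_one[of "x + i"] not_dvd_2i not_dvd_2i_minus_2j ij
      by auto
  qed
  have s_const: "s (a * i + b * j) = s 0" for a b
    using int_translation_invariant[of s i 0 a] int_translation_invariant[of s j "a * i" b] s_i sd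
    by simp
  have d_const: "d (a * i + b * j) = d 0" for a b
    using int_translation_invariant[of d i 0 a] int_translation_invariant[of d j "a * i" b] d_j sd
    by simp
  obtain \<alpha> \<beta> where \<alpha>\<beta>: "n dvd 1 - \<alpha> * i - \<beta> * j"
    by (rule bezout)
  have "n dvd g x - g 0 - (\<alpha> * (s 0 * i) + \<beta> * (d 0 * j)) * x" for x
  proof -
    \<comment> \<open>Walk from 0 to \<open>y\<close>, which is \<open>x\<close> modulo \<open>n\<close>, by \<open>x * \<alpha>\<close> steps \<open>i\<close> and then \<open>x * \<beta>\<close> steps \<open>j\<close>.\<close>
    define y where "y = x * \<alpha> * i + x * \<beta> * j"
    have "n dvd g (0 + k * i + i) - g (0 + k * i) - s 0 * i" for k
      using s(1)[of "k * i"] s_const[of k 0] by simp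
    then have 1: "n dvd g (0 + x * \<alpha> * i) - g 0 - (x * \<alpha>) * (s 0 * i)"
      by (rule progression_increments)
    have "n dvd g (x * \<alpha> * i + k * j + j) - g (x * \<alpha> * i + k * j) - d 0 * j" for k
      using d(1)[of "x * \<alpha> * i + k * j"] d_const[of "x * \<alpha>" k] by simp
    then have 2: "n dvd g y - g (x * \<alpha> * i) - (x * \<beta>) * (d 0 * j)"
      unfolding y_def by (rule progression_increments)
    have "x - y = x * (1 - \<alpha> * i - \<beta> * j)"
      by (simp add: y_def algebra_simps)
    then have "n dvd g x - g y"
      using \<alpha>\<beta> by (intro periodic) simp
    from dvd_add[OF this dvd_add[OF 2 1]] show ?thesis
      by (simp add: algebra_simps)
  qed
  then show ?thesis
    by blast
qed

text \<open>Here the \<open>i\<close>-steps run through all of \<open>\<int>\<^sub>n\<close>, so constancy of the one sign \<open>s\<close> is enough.\<close>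

lemma affine_of_one_cycle:
  fixes g :: "int \<Rightarrow> int"
  assumes i: "i = 1"
    and inj: "\<And>x y. n dvd g x - g y \<Longrightarrow> n dvd x - y"
    and gi: "\<And>x. n dvd g (x + i) - g x - i \<or> n dvd g (x + i) - g x + i"
  shows "\<exists>t. \<forall>x. n dvd g x - g 0 - t * x"
proof -
  define s where "s x = (if n dvd g (x + i) - g x - i then 1 else - 1 :: int)" for x
  have s: "n dvd g (x + i) - g x - s x * i" "s x = 1 \<or> s x = - 1" for x
    using gi[of x] by (auto simp: s_def)
  have s_i: "s (x + i) = s x" for x
    using not_dvd_2i inj s by (rule sign_constant_along_cycle)
  have s_const: "s k = s 0" for k
    using int_translation_invariant[of s i 0 k] s_i i by simp
  have "n dvd g (0 + k * i + i) - g (0 + k * i) - s 0" for k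
    using s(1)[of k] s_const[of k] i by simp
  then have "n dvd g (0 + x * i) - g 0 - x * s 0" for x
    by (rule progression_increments)
  then show ?thesis
    using i by (intro exI[of _ "s 0"]) (simp add: mult.commute)
qed

lemma units_iff: "x \<in> Units (residue_ring n) \<longleftrightarrow> 0 < x \<and> x < n \<and> coprime x n"
proof -
  interpret residues n "residue_ring n"
    using n_ge_4 by unfold_locales auto
  show ?thesis
    by (simp add: res_units_eq)
qed

text \<open>If \<open>2 (i + j) = 0\<close> in \<open>\<int>\<^sub>n\<close>, then a prime \<open>q\<close> dividing \<open>n\<close> and one of \<open>i, j\<close> divides twice the
  other one but not the other one itself, so \<open>q = 2\<close>. When both are non-units, \<open>n\<close>, \<open>i\<close> and \<open>j\<close> are
  all even.\<close>

lemma not_dvd_2i_plus_2j: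
  assumes "i \<notin> Units (residue_ring n)" "j \<notin> Units (residue_ring n)"
  shows "\<not> n dvd 2 * i + 2 * j"
proof
  assume dvd: "n dvd 2 * i + 2 * j"
  have even: "even x \<and> even n"
    if xy: "{x, y} = {i, j}" and x: "x \<notin> Units (residue_ring n)" for x y
  proof -
    have "\<not> coprime x n"
      using that i_pos i_less_j j_le_half by (auto simp: units_iff doubleton_eq_iff)
    then have "\<not> is_unit (gcd x n)" "gcd x n \<noteq> 0"
      using n_ge_4 by (auto simp: coprime_iff_gcd_eq_1)
    then obtain q where q: "prime q" "q dvd x" "q dvd n"
      using prime_divisor_exists[of "gcd x n"] by auto
    have "q dvd 2 * i + 2 * j"
      using q dvd by (auto intro: dvd_trans)
    then have "q dvd 2 * y"
      using xy q(2) by (auto simp: doubleton_eq_iff) (metis dvd_add_right_iff dvd_add_left_iff dvd_mult)+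
    moreover have "\<not> q dvd y"
    proof
      assume "q dvd y"
      then have "q dvd gcd n (gcd i j)"
        using q xy by (auto simp: doubleton_eq_iff)
      then show False
        using gcd_one q(1) by auto
    qed
    ultimately have "q dvd 2"
      using q(1) prime_dvd_mult_iff by blast
    then have "q = 2"
      using q(1) primes_dvd_imp_eq two_is_prime by blast
    then show ?thesis
      using q by simp
  qed
  have "even i" "even j" "even n"
    using even[of i j] even[of j i] assms by auto
  then have "2 dvd gcd n (gcd i j)"
    by simp
  then show False
    using gcd_one by simp
qed

lemma affine_of_edge_preserving:
  fixes g :: "int \<Rightarrow> int"
  assumes unit: "i = 1 \<or> (i \<notin> Units (residue_ring n) \<and> j \<notin> Units (residue_ring n))"
    and periodic: "\<And>x y. n dvd x - y \<Longrightarrow> n dvd g x - g y"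
    and inj: "\<And>x y. n dvd g x - g y \<Longrightarrow> n dvd x - y"
    and gi: "\<And>x. n dvd g (x + i) - g x - i \<or> n dvd g (x + i) - g x + i"
    and gj: "\<And>x. n dvd g (x + j) - g x - j \<or> n dvd g (x + j) - g x + j"
  shows "\<exists>t. \<forall>x. n dvd g x - g 0 - t * x"
  using unit
proof
  assume "i = 1"
  then show ?thesis
    using inj gi by (rule affine_of_one_cycle)
next
  assume "i \<notin> Units (residue_ring n) \<and> j \<notin> Units (residue_ring n)"
  then have "\<not> n dvd 2 * i + 2 * j"
    by (simp add: not_dvd_2i_plus_2j)
  from this periodic inj gi gj show ?thesis
    by (rule affine_of_square_condition)
qed


section \<open>Multipliers that preserve the connection set\<close>

text \<open>Membership in \<open>connection_units\<close>, but for arbitrary integer representatives and without asking for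
  a unit: lemma \<open>sign_multiplier_coprime\<close> supplies that.\<close>

definition sign_multiplier :: "int \<Rightarrow> bool" where
  "sign_multiplier t \<longleftrightarrow>
     (n dvd t * i - i \<or> n dvd t * i + i) \<and> (n dvd t * j - j \<or> n dvd t * j + j)"

text \<open>A common divisor of \<open>t\<close> and \<open>n\<close> divides \<open>t x\<close> and \<open>t x \<mp> x\<close>, hence divides \<open>x\<close>, for both
  \<open>x = i\<close> and \<open>x = j\<close>.\<close>

lemma sign_multiplier_coprime:
  assumes "sign_multiplier t"
  shows "coprime t n"
proof (rule coprimeI)
  fix c assume c: "c dvd t" "c dvd n"
  have "c dvd x" if "n dvd t * x - x \<or> n dvd t * x + x" for x
  proof -
    have "c dvd t * x - x \<or> c dvd t * x + x"
      using that c(2) dvd_trans by blast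
    moreover have "c dvd t * x"
      using c(1) by simp
    ultimately show ?thesis
      using dvd_add_right_iff dvd_diff_right_iff by blast
  qed
  then have "c dvd i" "c dvd j"
    using assms by (auto simp: sign_multiplier_def)
  then have "c dvd gcd n (gcd i j)"
    using c by simp
  then show "is_unit c"
    using gcd_one by simp
qed

lemma pm_eq_iff: "pm n a = pm n b \<longleftrightarrow> n dvd a - b \<or> n dvd a + b"
proof -
  have "(- a) mod n = (- b) mod n \<longleftrightarrow> n dvd a - b" "(- a) mod n = b mod n \<longleftrightarrow> n dvd a + b"
    using dvd_minus_iff[of n "a - b"] dvd_minus_iff[of n "a + b"]
    by (simp_all add: mod_eq_dvd_iff add.commute)
  moreover have "a mod n = b mod n \<longleftrightarrow> n dvd a - b" "a mod n = (- b) mod n \<longleftrightarrow> n dvd a + b"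
    by (simp_all add: mod_eq_dvd_iff)
  ultimately show ?thesis
    unfolding pm_def doubleton_eq_iff by blast
qed

lemma image_mult_pm: "(\<lambda>x. t * x mod n) ` pm n a = pm n (t * a)"
  by (simp add: pm_def mod_mult_right_eq)

lemma connection_units_iff: "t \<in> connection_units n i j \<longleftrightarrow> 0 \<le> t \<and> t < n \<and> sign_multiplier t"
proof -
  have "0 < t \<and> coprime t n" if "0 \<le> t" "sign_multiplier t"
    using that sign_multiplier_coprime[of t] n_ge_4 by (cases "t = 0") auto
  then show ?thesis
    unfolding connection_units_def by (auto simp: units_iff image_mult_pm pm_eq_iff sign_multiplier_def)
qed

lemma sign_multiplier_cong:
  assumes "n dvd t - u"
  shows "sign_multiplier t \<longleftrightarrow> sign_multiplier u"
proof -
  have "n dvd (t - u) * x" for x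
    using assms by simp
  then have "n dvd t * x - y \<longleftrightarrow> n dvd u * x - y" for x y
    using dvd_add_right_iff[of n "(t - u) * x" "u * x - y"] by (simp add: left_diff_distrib)
  from this[of x x for x] this[of x "- x" for x]
  have "n dvd t * x - x \<longleftrightarrow> n dvd u * x - x" "n dvd t * x + x \<longleftrightarrow> n dvd u * x + x" for x
    by simp_all
  then show ?thesis
    by (simp add: sign_multiplier_def)
qed

lemma connection_units_eq_pm_one_iff:
  "connection_units n i j = pm n 1 \<longleftrightarrow> (\<forall>t. sign_multiplier t \<longrightarrow> n dvd t - 1 \<or> n dvd t + 1)"
proof -
  have mem: "t mod n \<in> connection_units n i j \<longleftrightarrow> sign_multiplier t" for t
  proof -
    have "n dvd t mod n - t"
      by (simp add: mod_eq_dvd_iff[symmetric])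
    then show ?thesis
      using sign_multiplier_cong n_ge_4 by (simp add: connection_units_iff)
  qed
  have one: "t mod n \<in> pm n 1 \<longleftrightarrow> n dvd t - 1 \<or> n dvd t + 1" for t
    by (simp add: pm_def mod_eq_dvd_iff)
  have multiplier: "sign_multiplier t" if "n dvd t - 1 \<or> n dvd t + 1" for t
    using that
  proof
    assume "n dvd t - 1"
    then have "n dvd t * x - x" for x
      unfolding dvd_def by Groebner_Basis.algebra
    then show ?thesis
      by (simp add: sign_multiplier_def)
  next
    assume "n dvd t + 1"
    then have "n dvd t * x + x" for x
      unfolding dvd_def by Groebner_Basis.algebra
    then show ?thesis
      by (simp add: sign_multiplier_def)
  qed
  have reduced: "x = x mod n" if "x \<in> connection_units n i j \<union> pm n 1" for x
    using that by (auto simp: connection_units_iff pm_def)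
  show ?thesis
  proof
    assume "connection_units n i j = pm n 1"
    then show "\<forall>t. sign_multiplier t \<longrightarrow> n dvd t - 1 \<or> n dvd t + 1"
      using mem one by blast
  next
    assume only: "\<forall>t. sign_multiplier t \<longrightarrow> n dvd t - 1 \<or> n dvd t + 1"
    have "x mod n \<in> connection_units n i j \<longleftrightarrow> x mod n \<in> pm n 1" for x
      using only mem one multiplier by blast
    then show "connection_units n i j = pm n 1"
      using reduced by (metis UnCI subsetI subset_antisym)
  qed
qed


section \<open>Hubs, paths and adjacency\<close>

abbreviation G :: "sc_vertex sgraph" where
  "G \<equiv> subdivided_circulant n i p j"

definition hub :: "int \<Rightarrow> sc_vertex" where
  "hub a = U (a mod n)"

text \<open>Both ends are included: position 0 is the hub \<open>a\<close> and position \<open>p + 1\<close> the hub \<open>a + i\<close>. All path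
  edges then have the same form, and reversing a path is \<open>r \<mapsto> p + 1 - r\<close>.\<close>

definition path_vertex :: "int \<Rightarrow> nat \<Rightarrow> sc_vertex" where
  "path_vertex a r = (if r = 0 then hub a else if r \<le> p then V (a mod n) r else hub (a + i))"

lemma path_vertex_0 [simp]: "path_vertex a 0 = hub a"
  and path_vertex_last [simp]: "path_vertex a (Suc p) = hub (a + i)"
  by (simp_all add: path_vertex_def)

lemma hub_eq_iff [simp]: "hub a = hub b \<longleftrightarrow> n dvd a - b"
  by (simp add: hub_def mod_eq_dvd_iff)

lemma inner_eq_iff:
  assumes "0 < r" "r \<le> p" "0 < s" "s \<le> p"
  shows "path_vertex a r = path_vertex b s \<longleftrightarrow> r = s \<and> n dvd a - b"
  using assms by (auto simp: path_vertex_def mod_eq_dvd_iff)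

lemma inner_neq_hub:
  assumes "0 < r" "r \<le> p"
  shows "path_vertex a r \<noteq> hub b"
  using assms by (simp add: path_vertex_def hub_def)

lemma path_vertex_cong: "n dvd a - b \<Longrightarrow> path_vertex a r = path_vertex b r"
  by (simp add: path_vertex_def mod_eq_dvd_iff)

lemma hub_in_verts [simp]: "hub a \<in> verts G"
  using n_ge_4 by (simp add: subdivided_circulant_def hub_def)

lemma path_vertex_in_verts [simp]: "path_vertex a r \<in> verts G"
  using n_ge_4 by (auto simp: path_vertex_def) (simp add: subdivided_circulant_def)

lemma vertex_cases:
  assumes "v \<in> verts G"
  obtains a where "v = hub a" | a r where "v = path_vertex a r" "0 < r" "r \<le> p"
proof -
  consider a where "v = U a" "0 \<le> a" "a < n"
    | a r where "v = V a r" "0 \<le> a" "a < n" "1 \<le> r" "r \<le> p"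
    using assms by (auto simp: subdivided_circulant_def)
  then show thesis
  proof cases
    case (1 a)
    then show ?thesis
      using that(1)[of a] by (simp add: hub_def)
  next
    case (2 a r)
    then show ?thesis
      using that(2)[of a r] by (simp add: path_vertex_def)
  qed
qed

lemma edges_G:
  "edges G = range (\<lambda>x. {hub x, hub (x + j)})
     \<union> {{path_vertex a r, path_vertex a (Suc r)} | a r. r \<le> p}"
proof -
  have reduce: "path_vertex (a mod n) r = path_vertex a r" for a r
    using n_ge_4 by (intro path_vertex_cong) (simp add: mod_eq_dvd_iff[symmetric])
  have nth: "subdivision_path n i p a ! r = path_vertex a r"
    if "a \<in> {0..<n}" "r < p + 2" for a r
    using that by (cases r)
      (auto simp: subdivision_path_def nth_append path_vertex_def hub_def simp del: upt_Suc)
  have path: "path_edges (subdivision_path n i p a) = {{path_vertex a r, path_vertex a (Suc r)} | r. r \<le> p}"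
    if a: "a \<in> {0..<n}" for a
  proof -
    have len: "length (subdivision_path n i p a) = p + 2"
      by (simp add: subdivision_path_def)
    have "{subdivision_path n i p a ! r, subdivision_path n i p a ! Suc r}
        = {path_vertex a r, path_vertex a (Suc r)} \<and> (Suc r < p + 2 \<longleftrightarrow> r \<le> p)" if "r \<le> p \<or> Suc r < p + 2" for r
      using that nth[OF a] by auto
    then show ?thesis
      unfolding path_edges_def len by blast
  qed
  have "(\<Union>a \<in> {0..<n}. path_edges (subdivision_path n i p a))
      = {{path_vertex a r, path_vertex a (Suc r)} | a r. r \<le> p}" (is "?L = ?R")
  proof
    show "?L \<subseteq> ?R"
      using path by auto
    show "?R \<subseteq> ?L"
    proof
      fix e assume "e \<in> ?R"
      then obtain a r where e: "e = {path_vertex a r, path_vertex a (Suc r)}" "r \<le> p"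
        by blast
      have "a mod n \<in> {0..<n}"
        using n_ge_4 by simp
      moreover have "e \<in> path_edges (subdivision_path n i p (a mod n))"
        unfolding path[OF \<open>a mod n \<in> {0..<n}\<close>] using e by (auto simp: reduce)
      ultimately show "e \<in> ?L"
        by blast
    qed
  qed
  moreover have "{{U a, U ((a + j) mod n)} | a. a \<in> {0..<n}} = range (\<lambda>x. {hub x, hub (x + j)})"
    (is "?L = ?R")
  proof
    show "?L \<subseteq> ?R"
    proof
      fix e assume "e \<in> ?L"
      then obtain a where "a \<in> {0..<n}" "e = {U a, U ((a + j) mod n)}"
        by blast
      then have "e = {hub a, hub (a + j)}"
        by (simp add: hub_def)
      then show "e \<in> ?R"
        by blast
    qed
    show "?R \<subseteq> ?L"
    proof
      fix e assume "e \<in> ?R"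
      then obtain x where "e = {hub x, hub (x + j)}"
        by blast
      then have "e = {U (x mod n), U ((x mod n + j) mod n)}" "x mod n \<in> {0..<n}"
        using n_ge_4 by (auto simp: hub_def mod_add_left_eq)
      then show "e \<in> ?L"
        by blast
    qed
  qed
  ultimately show ?thesis
    by (simp add: subdivided_circulant_def)
qed

abbreviation adjacent :: "sc_vertex \<Rightarrow> sc_vertex \<Rightarrow> bool" where
  "adjacent x y \<equiv> {x, y} \<in> edges G"

lemma adjacent_hub:
  assumes "adjacent (hub a) y"
  shows "y = hub (a + j) \<or> y = hub (a - j) \<or> y = path_vertex a 1 \<or> y = path_vertex (a - i) p"
  using assms unfolding edges_G
proof
  assume "{hub a, y} \<in> range (\<lambda>x. {hub x, hub (x + j)})"
  then obtain x where "{hub a, y} = {hub x, hub (x + j)}"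
    by blast
  then consider "n dvd a - x" "y = hub (x + j)" | "n dvd a - (x + j)" "y = hub x"
    by (auto simp: doubleton_eq_iff)
  then show ?thesis
    by cases (simp_all add: algebra_simps dvd_diff_commute)
next
  assume "{hub a, y} \<in> {{path_vertex a r, path_vertex a (Suc r)} | a r. r \<le> p}"
  then obtain b r where r: "r \<le> p" and e: "{hub a, y} = {path_vertex b r, path_vertex b (Suc r)}"
    by blast
  then consider "hub a = path_vertex b r" "y = path_vertex b (Suc r)"
    | "hub a = path_vertex b (Suc r)" "y = path_vertex b r"
    by (auto simp: doubleton_eq_iff)
  then show ?thesis
  proof cases
    case 1
    then have "r = 0"
      using r inner_neq_hub[of r b a] by (metis gr0I)
    then show ?thesis
      using 1 path_vertex_cong[of b a 1] by (simp add: dvd_diff_commute)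
  next
    case 2
    then have "r = p"
      using r inner_neq_hub[of "Suc r" b a] by (metis le_antisym not_less_eq_eq zero_less_Suc)
    then show ?thesis
      using 2 path_vertex_cong[of b "a - i" p] by (simp add: dvd_diff_commute algebra_simps)
  qed
qed

lemma adjacent_hub_hub: "adjacent (hub a) (hub b) \<longleftrightarrow> n dvd b - a - j \<or> n dvd b - a + j"
proof
  assume "adjacent (hub a) (hub b)"
  then show "n dvd b - a - j \<or> n dvd b - a + j"
    using adjacent_hub[of a "hub b"] inner_neq_hub[of 1 a b] inner_neq_hub[of p "a - i" b] p_pos
    by (auto simp: algebra_simps)
next
  assume "n dvd b - a - j \<or> n dvd b - a + j"
  then have "hub b = hub (a + j) \<or> hub a = hub (b + j)"
    by (auto simp: algebra_simps dvd_diff_commute)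
  then have "{hub a, hub b} = {hub a, hub (a + j)} \<or> {hub a, hub b} = {hub b, hub (b + j)}"
    by (metis insert_commute)
  then show "adjacent (hub a) (hub b)"
    unfolding edges_G by blast
qed

lemma adjacent_inner:
  assumes "r < p"
  shows "adjacent (path_vertex a (Suc r)) y \<longleftrightarrow> y = path_vertex a r \<or> y = path_vertex a (Suc (Suc r))"
proof
  assume "adjacent (path_vertex a (Suc r)) y"
  moreover have "path_vertex a (Suc r) \<noteq> hub x" for x
    using assms by (intro inner_neq_hub) auto
  ultimately obtain b s where s: "s \<le> p"
    and e: "{path_vertex a (Suc r), y} = {path_vertex b s, path_vertex b (Suc s)}"
    unfolding edges_G by (auto simp: doubleton_eq_iff)
  then consider "path_vertex a (Suc r) = path_vertex b s" "y = path_vertex b (Suc s)"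
    | "path_vertex a (Suc r) = path_vertex b (Suc s)" "y = path_vertex b s"
    by (auto simp: doubleton_eq_iff)
  then show "y = path_vertex a r \<or> y = path_vertex a (Suc (Suc r))"
  proof cases
    case 1
    then have "0 < s"
      using inner_neq_hub[of "Suc r" a b] assms by (cases "s = 0") auto
    then have "s = Suc r \<and> n dvd a - b"
      using 1 s assms inner_eq_iff[of "Suc r" s a b] by simp
    then show ?thesis
      using 1 path_vertex_cong[of a b] by simp
  next
    case 2
    then have "s < p"
      using inner_neq_hub[of "Suc r" a "b + i"] assms s by (cases "s = p") auto
    then have "s = r \<and> n dvd a - b"
      using 2 assms inner_eq_iff[of "Suc r" "Suc s" a b] by simp
    then show ?thesis
      using 2 path_vertex_cong[of a b] by simp
  qed
next
  assume "y = path_vertex a r \<or> y = path_vertex a (Suc (Suc r))"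
  then have "{path_vertex a (Suc r), y} = {path_vertex a r, path_vertex a (Suc r)}
    \<or> {path_vertex a (Suc r), y} = {path_vertex a (Suc r), path_vertex a (Suc (Suc r))}"
    by auto
  moreover have "r \<le> p" "Suc r \<le> p"
    using assms by auto
  ultimately show "adjacent (path_vertex a (Suc r)) y"
    unfolding edges_G by blast
qed

text \<open>A path traversed in either direction. Both directions are needed because an automorphism may
  reverse a path.\<close>

definition track :: "(nat \<Rightarrow> sc_vertex) \<Rightarrow> bool" where
  "track q \<longleftrightarrow> (\<exists>a. q = path_vertex a \<or> q = (\<lambda>r. path_vertex a (Suc p - r)))"

lemma track_path_vertex: "track (path_vertex a)"
  and track_reversed: "track (\<lambda>r. path_vertex a (Suc p - r))"
  by (auto simp: track_def)

lemma track_in_verts: "track q \<Longrightarrow> q k \<in> verts G"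
  by (auto simp: track_def)

text \<open>For \<open>p = 1\<close> this compares the two ends of a path, which differ because \<open>i \<noteq> 0\<close> in \<open>\<int>\<^sub>n\<close>. It
  makes a walk along a path without turning back unambiguous.\<close>

lemma path_vertex_skip_neq:
  assumes "r < p"
  shows "path_vertex a r \<noteq> path_vertex a (Suc (Suc r))"
proof (cases "r = 0")
  case True
  have "hub a \<noteq> path_vertex a (Suc (Suc 0))"
    using inner_neq_hub[of "Suc (Suc 0)" a a] path_vertex_last[of a] not_dvd_i p_pos
    by (cases "p = Suc 0") auto
  then show ?thesis
    using True by simp
next
  case False
  then show ?thesis
    using assms inner_neq_hub[of r a "a + i"] inner_eq_iff[of r "Suc (Suc r)" a a]
    by (cases "Suc r = p") auto
qed

lemma track_step:
  assumes "track q" "k < p"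
  shows "adjacent (q (Suc k)) y \<longleftrightarrow> y = q k \<or> y = q (Suc (Suc k))" "q k \<noteq> q (Suc (Suc k))"
proof -
  obtain a where "q = path_vertex a \<or> q = (\<lambda>r. path_vertex a (Suc p - r))"
    using assms by (auto simp: track_def)
  then have "(adjacent (q (Suc k)) y \<longleftrightarrow> y = q k \<or> y = q (Suc (Suc k))) \<and> q k \<noteq> q (Suc (Suc k))"
  proof
    assume "q = path_vertex a"
    then show ?thesis
      using adjacent_inner path_vertex_skip_neq assms(2) by simp
  next
    assume q: "q = (\<lambda>r. path_vertex a (Suc p - r))"
    obtain l where p: "p = Suc (k + l)"
      using assms(2) less_imp_Suc_add by blast
    have "q k = path_vertex a (Suc (Suc l))" "q (Suc k) = path_vertex a (Suc l)"
      "q (Suc (Suc k)) = path_vertex a l"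
      unfolding q by (rule arg_cong[where f = "path_vertex a"], simp add: p)+
    moreover have "l < p"
      using p by simp
    ultimately show ?thesis
      using adjacent_inner[of l a y] path_vertex_skip_neq[of l a] by metis
  qed
  then show "adjacent (q (Suc k)) y \<longleftrightarrow> y = q k \<or> y = q (Suc (Suc k))" "q k \<noteq> q (Suc (Suc k))"
    by blast+
qed


section \<open>Automorphisms are affine\<close>

lemma automorphism_adjacent:
  assumes "f \<in> automorphisms G" "x \<in> verts G" "y \<in> verts G"
  shows "adjacent (f x) (f y) \<longleftrightarrow> adjacent x y"
  using assms by (simp add: automorphisms_def)

lemma automorphism_eq_iff:
  assumes "f \<in> automorphisms G"
  shows "f x = f y \<longleftrightarrow> x = y"
  using permutes_inj[OF automorphism_permutes[OF assms]] by (simp add: inj_eq)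

lemma automorphism_in_verts:
  assumes "f \<in> automorphisms G"
  shows "f x \<in> verts G \<longleftrightarrow> x \<in> verts G"
  using permutes_in_image[OF automorphism_permutes[OF assms]] .

text \<open>A hub has the two path vertices next to it and the hub \<open>a + j\<close> as distinct neighbours, but an inner
  path vertex has only two.\<close>

lemma automorphism_maps_hub:
  assumes f: "f \<in> automorphisms G"
  shows "f (hub a) \<in> range hub"
proof (rule ccontr)
  assume no: "f (hub a) \<notin> range hub"
  have "f (hub a) \<in> verts G"
    using automorphism_in_verts[OF f] by simp
  then obtain b r where r: "f (hub a) = path_vertex b r" "0 < r" "r \<le> p"
    using no by (metis rangeI vertex_cases)
  then obtain s where s: "f (hub a) = path_vertex b (Suc s)" "s < p"
    by (cases r) auto
  have two: "f y = path_vertex b s \<or> f y = path_vertex b (Suc (Suc s))"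
    if "y \<in> verts G" "adjacent (hub a) y" for y
    using automorphism_adjacent[OF f hub_in_verts[of a] that(1)] that(2) s(1)
      adjacent_inner[OF s(2), of b "f y"] by simp
  have "adjacent (hub a) (path_vertex a 1)"
    unfolding edges_G One_nat_def by (metis (mono_tags, lifting) UnI2 le0 mem_Collect_eq path_vertex_0)
  moreover have "adjacent (hub a) (path_vertex (a - i) p)"
  proof -
    have "{hub a, path_vertex (a - i) p} = {path_vertex (a - i) p, path_vertex (a - i) (Suc p)}"
      by auto
    then show ?thesis
      unfolding edges_G by blast
  qed
  moreover have "adjacent (hub a) (hub (a + j))"
    by (simp add: adjacent_hub_hub)
  moreover have "path_vertex a 1 \<noteq> path_vertex (a - i) p"
    using inner_eq_iff[of 1 p a "a - i"] p_pos not_dvd_i by simp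
  moreover have "path_vertex a 1 \<noteq> hub (a + j)" "path_vertex (a - i) p \<noteq> hub (a + j)"
    using inner_neq_hub p_pos by simp_all
  ultimately show False
    using two automorphism_eq_iff[OF f] by (metis hub_in_verts path_vertex_in_verts)
qed

lemma automorphism_maps_inner:
  assumes f: "f \<in> automorphisms G" and r: "0 < r" "r \<le> p"
  shows "f (path_vertex a r) \<notin> range hub"
proof
  assume "f (path_vertex a r) \<in> range hub"
  moreover have "f ` range hub = range hub"
  proof (rule endo_inj_surj)
    have "finite (verts G)"
      using simple_graph_subdivided_circulant[of j n p i] i_pos i_less_j j_le_half p_pos
      by (simp add: simple_graph_def)
    then show "finite (range hub)"
      by (rule rev_finite_subset) auto
    show "inj_on f (range hub)"
      using automorphism_eq_iff[OF f] by (simp add: inj_on_def)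
  qed (use automorphism_maps_hub[OF f] in blast)
  ultimately obtain x where "f (path_vertex a r) = f (hub x)"
    by (metis (no_types, lifting) imageE)
  then show False
    using automorphism_eq_iff[OF f] inner_neq_hub[OF r] by simp
qed

text \<open>Once the first step is known, every later vertex is the only neighbour of its predecessor that has
  not just been left.\<close>

lemma automorphism_track:
  assumes f: "f \<in> automorphisms G" and q: "track q" "track q'"
    and start: "f (q 0) = q' 0" "f (q 1) = q' 1" and k: "k \<le> Suc p"
  shows "f (q k) = q' k"
proof -
  have "f (q k) = q' k \<and> f (q (Suc k)) = q' (Suc k)" if "k \<le> p" for k
    using that
  proof (induction k)
    case 0
    then show ?case
      using start by simp
  next
    case (Suc k)
    then have IH: "f (q k) = q' k" "f (q (Suc k)) = q' (Suc k)" and k: "k < p"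
      by auto
    have "adjacent (q (Suc k)) (q (Suc (Suc k)))"
      using track_step(1)[OF q(1) k] by simp
    then have "adjacent (q' (Suc k)) (f (q (Suc (Suc k))))"
      using automorphism_adjacent[OF f track_in_verts track_in_verts, OF q(1) q(1)] IH by metis
    moreover have "f (q (Suc (Suc k))) \<noteq> q' k"
      using track_step(2)[OF q(1) k] automorphism_eq_iff[OF f] IH by metis
    ultimately show ?case
      using track_step(1)[OF q(2) k] IH by blast
  qed
  then show ?thesis
    using k by (cases k) (use start in auto)
qed

text \<open>The two alternatives are the two paths leaving the hub \<open>b\<close>: the one towards \<open>b + i\<close>, and the one
  towards \<open>b - i\<close>, which is traversed backwards.\<close>

lemma automorphism_path:
  assumes f: "f \<in> automorphisms G" and ab: "f (hub a) = hub b"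
  shows "(\<forall>r \<le> Suc p. f (path_vertex a r) = path_vertex b r)
       \<or> (\<forall>r \<le> Suc p. f (path_vertex a r) = path_vertex (b - i) (Suc p - r))"
proof -
  have "adjacent (path_vertex a 0) (path_vertex a (Suc 0))"
    unfolding edges_G by blast
  then have "adjacent (hub b) (f (path_vertex a 1))"
    using automorphism_adjacent[OF f, of "hub a" "path_vertex a 1"] ab by simp
  then have "f (path_vertex a 1) = path_vertex b 1 \<or> f (path_vertex a 1) = path_vertex (b - i) p"
    using adjacent_hub automorphism_maps_inner[OF f, of 1 a] p_pos by (metis rangeI zero_less_one)
  then show ?thesis
  proof
    assume "f (path_vertex a 1) = path_vertex b 1"
    then show ?thesis
      using automorphism_track[OF f track_path_vertex track_path_vertex, of a b] ab by simp
  next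
    assume "f (path_vertex a 1) = path_vertex (b - i) p"
    then show ?thesis
      using automorphism_track[OF f track_path_vertex track_reversed, of a "b - i"] ab by simp
  qed
qed

text \<open>Only the backward alternative of lemma \<open>automorphism_path\<close> could move a path vertex, and it would
  send the hub \<open>a + i\<close> to the hub \<open>a - i\<close>.\<close>

lemma automorphism_eq_id:
  assumes f: "f \<in> automorphisms G" and hubs: "\<And>a. f (hub a) = hub a"
  shows "f = id"
proof
  fix v
  show "f v = id v"
  proof (cases "v \<in> verts G")
    case True
    then show ?thesis
    proof (cases rule: vertex_cases)
      case (2 a r)
      have "f (path_vertex a (Suc p)) \<noteq> path_vertex (a - i) (Suc p - Suc p)"
        using hubs[of "a + i"] not_dvd_2i by simp
      then have "\<forall>r \<le> Suc p. f (path_vertex a r) = path_vertex a r"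
        using automorphism_path[OF f hubs[of a]] by blast
      then show ?thesis
        using 2 by simp
    qed (use hubs in simp)
  next
    case False
    then show ?thesis
      using permutes_not_in[OF automorphism_permutes[OF f]] by simp
  qed
qed

lemma automorphism_affine:
  assumes unit: "i = 1 \<or> (i \<notin> Units (residue_ring n) \<and> j \<notin> Units (residue_ring n))"
    and f: "f \<in> automorphisms G"
  obtains b t where "sign_multiplier t" "\<And>x. f (hub x) = hub (b + t * x)"
proof -
  obtain g where g: "\<And>x. f (hub x) = hub (g x)"
    using automorphism_maps_hub[OF f] unfolding image_iff by metis
  have g_iff: "n dvd g x - g y \<longleftrightarrow> n dvd x - y" for x y
    using automorphism_eq_iff[OF f, of "hub x" "hub y"] g by simp
  have gi: "n dvd g (x + i) - g x - i \<or> n dvd g (x + i) - g x + i" for x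
  proof -
    have "f (hub (x + i)) = hub (g x + i) \<or> f (hub (x + i)) = hub (g x - i)"
      using automorphism_path[OF f g[of x]] by (metis le_refl diff_self_eq_0 path_vertex_0 path_vertex_last)
    then show ?thesis
      by (auto simp: g algebra_simps)
  qed
  have gj: "n dvd g (x + j) - g x - j \<or> n dvd g (x + j) - g x + j" for x
  proof -
    have "adjacent (hub x) (hub (x + j))"
      by (simp add: adjacent_hub_hub)
    then show ?thesis
      using automorphism_adjacent[OF f, of "hub x" "hub (x + j)"] by (simp add: g adjacent_hub_hub)
  qed
  obtain t where t: "\<And>x. n dvd g x - g 0 - t * x"
    using affine_of_edge_preserving[OF unit _ _ gi gj] g_iff by blast
  have "n dvd t * m - m \<or> n dvd t * m + m"
    if "n dvd g (0 + m) - g 0 - m \<or> n dvd g (0 + m) - g 0 + m" for m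
    using that
  proof
    assume "n dvd g (0 + m) - g 0 - m"
    then have "n dvd t * m - m"
      using t[of m] unfolding add_0 dvd_def by Groebner_Basis.algebra
    then show ?thesis ..
  next
    assume "n dvd g (0 + m) - g 0 + m"
    then have "n dvd t * m + m"
      using t[of m] unfolding add_0 dvd_def by Groebner_Basis.algebra
    then show ?thesis ..
  qed
  then have "sign_multiplier t"
    using gi[of 0] gj[of 0] by (auto simp: sign_multiplier_def)
  moreover have "f (hub x) = hub (g 0 + t * x)" for x
    using t[of x] by (simp add: g algebra_simps)
  ultimately show thesis
    using that by blast
qed

text \<open>If \<open>t i = i\<close>, paths keep their direction. If \<open>t i = -i\<close>, the path from \<open>a\<close> to \<open>a + i\<close> goes to the
  path between \<open>b + t a - i\<close> and \<open>b + t a\<close>, traversed backwards.\<close>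

lemma affine_automorphism:
  assumes t: "sign_multiplier t"
  shows "\<exists>f \<in> automorphisms G. (\<forall>x. f (hub x) = hub (b + t * x))
    \<and> (n dvd t * i - i \<longrightarrow> (\<forall>a. \<forall>r \<le> Suc p. f (path_vertex a r) = path_vertex (b + t * a) r))
    \<and> (n dvd t * i + i \<longrightarrow>
         (\<forall>a. \<forall>r \<le> Suc p. f (path_vertex a r) = path_vertex (b + t * a - i) (Suc p - r)))"
proof -
  \<comment> \<open>\<open>Q a r\<close> is the image of position \<open>r\<close> on the path starting at the hub \<open>a\<close>.\<close>
  define Q where "Q a r = (if n dvd t * i - i then path_vertex (b + t * a) r
    else path_vertex (b + t * a - i) (Suc p - r))" for a r
  define h where "h v = (case v of U x \<Rightarrow> hub (b + t * x) | V a r \<Rightarrow> Q a r)" for v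
  have reduce: "n dvd (b + t * (x mod n)) - (b + t * x)" for x
  proof -
    have "n dvd x mod n - x"
      by (simp add: mod_eq_dvd_iff[symmetric])
    then have "n dvd t * (x mod n - x)"
      by simp
    then show ?thesis
      by (simp add: algebra_simps)
  qed
  have h_hub: "h (hub x) = hub (b + t * x)" for x
    using reduce[of x] by (simp add: h_def hub_def[of x])
  have Q_reduce: "Q (x mod n) r = Q x r" for x r
    using reduce[of x] path_vertex_cong by (auto simp: Q_def)
  have Q_0: "Q a 0 = hub (b + t * a)" for a
    by (simp add: Q_def)
  have neg: "n dvd t * i + i" if "\<not> n dvd t * i - i"
    using that t by (auto simp: sign_multiplier_def)
  have Q_last: "Q a (Suc p) = hub (b + t * (a + i))" for a
  proof (cases "n dvd t * i - i")
    case True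
    have "(b + t * (a + i)) - (b + t * a + i) = t * i - i"
      by (simp add: algebra_simps)
    then have "hub (b + t * (a + i)) = hub (b + t * a + i)"
      using True by (simp only: hub_eq_iff)
    then show ?thesis
      using True by (simp add: Q_def del: hub_eq_iff)
  next
    case False
    have "(b + t * a - i) - (b + t * (a + i)) = - (t * i + i)"
      by (simp add: algebra_simps)
    then have "hub (b + t * a - i) = hub (b + t * (a + i))"
      using neg[OF False] by (simp only: hub_eq_iff dvd_minus_iff)
    then show ?thesis
      using False by (simp add: Q_def del: hub_eq_iff)
  qed
  have h_path: "h (path_vertex a r) = Q a r" if r: "r \<le> Suc p" for a r
  proof -
    consider "r = 0" | "0 < r" "r \<le> p" | "r = Suc p"
      using r by (metis gr0I le_Suc_eq)
    then show ?thesis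
    proof cases
      case 2
      then show ?thesis
        by (simp add: path_vertex_def h_def Q_reduce)
    qed (simp_all add: h_hub Q_0 Q_last)
  qed
  let ?f = "\<lambda>v. if v \<in> verts G then h v else v"
  have cancel: "n dvd x - y" if "n dvd (b + t * x) - (b + t * y)" for x y
  proof -
    have "n dvd t * (x - y)"
      using that by (simp add: algebra_simps)
    then show ?thesis
      using sign_multiplier_coprime[OF t] coprime_commute coprime_dvd_mult_right_iff by blast
  qed
  have Q_eq: "r = s \<and> n dvd x - y" if "Q x r = Q y s" "0 < r" "r \<le> p" "0 < s" "s \<le> p" for x y r s
  proof (cases "n dvd t * i - i")
    case True
    then show ?thesis
      using that cancel[of x y] inner_eq_iff[of r s "b + t * x" "b + t * y"] by (simp add: Q_def)
  next
    case False
    then have "Suc p - r = Suc p - s \<and> n dvd (b + t * x - i) - (b + t * y - i)"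
      using that inner_eq_iff[of "Suc p - r" "Suc p - s" "b + t * x - i" "b + t * y - i"]
      by (auto simp: Q_def)
    moreover have "(b + t * x - i) - (b + t * y - i) = (b + t * x) - (b + t * y)"
      by simp
    ultimately show ?thesis
      using that cancel[of x y] by (metis Suc_diff_le diff_diff_cancel le_SucI)
  qed
  have Q_inner: "Q x r \<noteq> hub y" if "0 < r" "r \<le> p" for x y r
    using that inner_neq_hub[of r _ y] inner_neq_hub[of "Suc p - r" _ y] by (simp add: Q_def)
  have "?f \<in> automorphisms G"
  proof (rule automorphism_of_edge_preserving)
    show "simple_graph G"
      using simple_graph_subdivided_circulant[of j n p i] i_pos i_less_j j_le_half p_pos by simp
    show "inj_on h (verts G)"
    proof (rule inj_onI)
      fix v w assume "v \<in> verts G" "w \<in> verts G" "h v = h w"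
      from \<open>v \<in> verts G\<close> show "v = w"
      proof (cases rule: vertex_cases)
        case v: (1 x)
        from \<open>w \<in> verts G\<close> show ?thesis
        proof (cases rule: vertex_cases)
          case (1 y)
          then show ?thesis
            using \<open>h v = h w\<close> v cancel[of x y] by (simp add: h_hub)
        next
          case (2 y s)
          then have "Q y s = hub (b + t * x)"
            using \<open>h v = h w\<close> v by (simp add: h_hub h_path)
          then show ?thesis
            using 2 Q_inner by blast
        qed
      next
        case v: (2 x r)
        from \<open>w \<in> verts G\<close> show ?thesis
        proof (cases rule: vertex_cases)
          case (1 y)
          then have "Q x r = hub (b + t * y)"
            using \<open>h v = h w\<close> v by (simp add: h_hub h_path)
          then show ?thesis
            using v Q_inner by blast
        next
          case (2 y s)
          then have "r = s \<and> n dvd x - y"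
            using \<open>h v = h w\<close> v by (intro Q_eq) (simp_all add: h_path)
          then show ?thesis
            using 2 v path_vertex_cong by simp
        qed
      qed
    qed
    show "h ` verts G \<subseteq> verts G"
    proof
      fix w assume "w \<in> h ` verts G"
      then obtain v where "v \<in> verts G" "w = h v"
        by blast
      then show "w \<in> verts G"
        by (cases rule: vertex_cases) (simp_all add: h_hub h_path Q_def)
    qed
    fix e assume "e \<in> edges G"
    then consider x where "e = {hub x, hub (x + j)}"
      | a r where "e = {path_vertex a r, path_vertex a (Suc r)}" "r \<le> p"
      unfolding edges_G by blast
    then show "h ` e \<in> edges G"
    proof cases
      case (1 x)
      have "adjacent (hub (b + t * x)) (hub (b + t * (x + j)))"
        using t by (simp add: adjacent_hub_hub sign_multiplier_def algebra_simps)
      then show ?thesis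
        by (simp add: 1 h_hub)
    next
      case (2 a r)
      have "adjacent (Q a r) (Q a (Suc r))"
      proof (cases "n dvd t * i - i")
        case True
        then show ?thesis
          using 2(2) unfolding edges_G Q_def by auto
      next
        case False
        then have "{Q a r, Q a (Suc r)}
            = {path_vertex (b + t * a - i) (p - r), path_vertex (b + t * a - i) (Suc (p - r))}"
          using 2(2) by (auto simp: Q_def Suc_diff_le)
        then show ?thesis
          unfolding edges_G by (metis (mono_tags, lifting) UnI2 diff_le_self mem_Collect_eq)
      qed
      then show ?thesis
        using 2 by (simp add: h_path)
    qed
  qed
  moreover have "?f (hub x) = hub (b + t * x)" for x
    by (simp add: h_hub)
  moreover have "?f (path_vertex a r) = path_vertex (b + t * a) r"
    if "n dvd t * i - i" "r \<le> Suc p" for a r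
    using that by (simp add: h_path Q_def)
  moreover have "?f (path_vertex a r) = path_vertex (b + t * a - i) (Suc p - r)"
    if "n dvd t * i + i" "r \<le> Suc p" for a r
  proof -
    have "\<not> n dvd t * i - i"
      using that(1) not_dvd_2i dvd_diff[of n "t * i + i" "t * i - i"] by auto
    then show ?thesis
      using that by (simp add: h_path Q_def)
  qed
  ultimately show ?thesis
    by (intro bexI[of _ ?f]) blast+
qed


section \<open>Small determining sets and rigid sets\<close>

lemma affine_hub_map_id_iff:
  assumes f: "f \<in> automorphisms G" and affine: "\<And>x. f (hub x) = hub (b + t * x)"
  shows "f = id \<longleftrightarrow> n dvd b \<and> n dvd t - 1"
proof
  assume "f = id"
  then have b: "n dvd b" and 1: "n dvd b + t - 1"
    using affine[of 0] affine[of 1] dvd_minus_iff[of n b] dvd_diff_commute[of n 1 "b + t"] by auto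
  from dvd_diff[OF 1 b] b show "n dvd b \<and> n dvd t - 1"
    by simp
next
  assume "n dvd b \<and> n dvd t - 1"
  then have "n dvd b + (t - 1) * x" for x
    by simp
  then have "f (hub x) = hub x" for x
    by (simp add: affine left_diff_distrib add_diff_eq)
  then show "f = id"
    by (rule automorphism_eq_id[OF f])
qed

lemma sign_multiplier_minus: "sign_multiplier (- t) \<longleftrightarrow> sign_multiplier t"
proof -
  have "n dvd - t * x - x \<longleftrightarrow> n dvd t * x + x" "n dvd - t * x + x \<longleftrightarrow> n dvd t * x - x" for x
    using dvd_minus_iff[of n "t * x + x"] dvd_minus_iff[of n "t * x - x"] by simp_all
  then show ?thesis
    unfolding sign_multiplier_def by blast
qed

lemma sign_multiplier_one: "sign_multiplier 1"
  by (simp add: sign_multiplier_def)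

text \<open>The reflection \<open>x \<mapsto> 2 a - x\<close> fixes the hub \<open>a\<close>, and it is not the identity since \<open>n > 2\<close>.\<close>

lemma hub_not_determining: "\<not> determining_set G {hub a}"
proof
  assume W: "determining_set G {hub a}"
  have minus_one: "sign_multiplier (- 1)"
    by (simp add: sign_multiplier_minus sign_multiplier_one)
  obtain f where f: "f \<in> automorphisms G" "\<And>x. f (hub x) = hub (2 * a + (- 1) * x)"
    using affine_automorphism[OF minus_one, of "2 * a"] by blast
  then have "f = id"
    using W by (simp add: determining_set_def)
  then have "n dvd - 1 - 1"
    using affine_hub_map_id_iff[OF f] by blast
  then show False
    using not_dvd_small[of 2] n_ge_4 by simp
qed

text \<open>The reflection \<open>x \<mapsto> 2 a + i - x\<close> exchanges the ends \<open>a\<close> and \<open>a + i\<close> of the path and fixes its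
  only inner vertex.\<close>

lemma midpoint_not_determining:
  assumes "p = 1"
  shows "\<not> determining_set G {path_vertex a 1}"
proof
  assume W: "determining_set G {path_vertex a 1}"
  have minus_one: "sign_multiplier (- 1)"
    by (simp add: sign_multiplier_minus sign_multiplier_one)
  obtain f where f: "f \<in> automorphisms G" "\<And>x. f (hub x) = hub (2 * a + i + (- 1) * x)"
    and rev: "n dvd (- 1) * i + i \<Longrightarrow> \<forall>a'. \<forall>r \<le> Suc p.
       f (path_vertex a' r) = path_vertex (2 * a + i + (- 1) * a' - i) (Suc p - r)"
    using affine_automorphism[OF minus_one, of "2 * a + i"] by blast
  have "f (path_vertex a 1) = path_vertex a 1"
    using rev assms by simp
  then have "f = id"
    using W f(1) by (simp add: determining_set_def)
  then have "n dvd - 1 - 1"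
    using affine_hub_map_id_iff[OF f] by blast
  then show False
    using not_dvd_small[of 2] n_ge_4 by simp
qed

text \<open>Either \<open>t\<close> or \<open>-t\<close> fixes \<open>i\<close>, and neither is 1; the affine map with this multiplier that fixes
  the hub \<open>a\<close> then fixes the whole path from \<open>a\<close> to \<open>a + i\<close>.\<close>

lemma path_vertex_not_determining:
  assumes t: "sign_multiplier t" "\<not> n dvd t - 1" "\<not> n dvd t + 1" and r: "r \<le> Suc p"
  shows "\<not> determining_set G {path_vertex a r}"
proof
  assume W: "determining_set G {path_vertex a r}"
  obtain s where s: "sign_multiplier s" "n dvd s * i - i" "\<not> n dvd s - 1"
  proof (cases "n dvd t * i - i")
    case False
    then have "n dvd t * i + i"
      using t(1) by (simp add: sign_multiplier_def)
    then have "n dvd - t * i - i" "\<not> n dvd - t - 1"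
      using dvd_minus_iff[of n "t * i + i"] dvd_minus_iff[of n "t + 1"] t(3) by simp_all
    then show thesis
      using that[of "- t"] t(1) sign_multiplier_minus by blast
  qed (use that[of t] t in blast)
  obtain f where f: "f \<in> automorphisms G" "\<And>x. f (hub x) = hub (a - s * a + s * x)"
    and path: "n dvd s * i - i \<Longrightarrow> \<forall>a'. \<forall>r \<le> Suc p.
       f (path_vertex a' r) = path_vertex (a - s * a + s * a') r"
    using affine_automorphism[OF s(1), of "a - s * a"] by blast
  have "f (path_vertex a r) = path_vertex a r"
    using path[OF s(2)] r by simp
  then have "f = id"
    using W f(1) by (simp add: determining_set_def)
  then show False
    using affine_hub_map_id_iff[OF f] s(3) by blast
qed

lemma finite_verts: "finite (verts G)"
  using simple_graph_subdivided_circulant[of j n p i] i_pos i_less_j j_le_half p_pos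
  by (simp add: simple_graph_def)

lemma determining_set_nonempty:
  assumes "determining_set G W"
  shows "0 < card W"
proof -
  have "W \<noteq> {}"
  proof
    assume "W = {}"
    then have "determining_set G {hub 0}"
      using assms by (simp add: determining_set_def)
    then show False
      using hub_not_determining by blast
  qed
  moreover have "finite W"
    using assms finite_verts finite_subset by (auto simp: determining_set_def)
  ultimately show ?thesis
    by (simp add: card_gt_0_iff)
qed

lemma determining_set_two_vertices:
  assumes W: "determining_set G W" and exc: "\<not> (p \<ge> 2 \<and> connection_units n i j = pm n 1)"
  shows "2 \<le> card W"
proof (rule ccontr)
  assume "\<not> 2 \<le> card W"
  then have "card W = 1"
    using determining_set_nonempty[OF W] by linarith
  then obtain v where v: "W = {v}"
    by (rule card_1_singletonE)
  then have "v \<in> verts G"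
    using W by (simp add: determining_set_def)
  then show False
  proof (cases rule: vertex_cases)
    case 1
    then show ?thesis
      using W v hub_not_determining by simp
  next
    case (2 a r)
    show ?thesis
    proof (cases "connection_units n i j = pm n 1")
      case True
      then have "p = 1"
        using exc p_pos by simp
      then have "r = 1"
        using 2 by simp
      then show ?thesis
        using W v 2 midpoint_not_determining[OF \<open>p = 1\<close>] by simp
    next
      case False
      then obtain t where "sign_multiplier t" "\<not> n dvd t - 1" "\<not> n dvd t + 1"
        using connection_units_eq_pm_one_iff by blast
      then show ?thesis
        using W v 2 path_vertex_not_determining by simp
    qed
  qed
qed

text \<open>Reversing the path moves position 1 to position \<open>p\<close>, so an automorphism fixing position 1 can
  reverse the path only for \<open>p = 1\<close>.\<close>

lemma automorphism_fixing_inner: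
  assumes f: "f \<in> automorphisms G" and fixed: "f (path_vertex a 1) = path_vertex a 1"
  shows "(f (hub a) = hub a \<and> f (hub (a + i)) = hub (a + i)) \<or> (p = 1 \<and> f (hub a) = hub (a + i))"
proof -
  obtain b where b: "f (hub a) = hub b"
    using automorphism_maps_hub[OF f] by blast
  from automorphism_path[OF f b] show ?thesis
  proof
    assume path: "\<forall>r \<le> Suc p. f (path_vertex a r) = path_vertex b r"
    then have "path_vertex a 1 = path_vertex b 1"
      using fixed p_pos by simp
    then have ab: "n dvd a - b"
      using p_pos by (simp add: inner_eq_iff)
    have "f (hub (a + i)) = hub (b + i)"
      using path by (metis le_refl path_vertex_last)
    then show ?thesis
      using ab b by (simp add: dvd_diff_commute)
  next
    assume path: "\<forall>r \<le> Suc p. f (path_vertex a r) = path_vertex (b - i) (Suc p - r)"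
    then have "path_vertex a 1 = path_vertex (b - i) p"
      using fixed p_pos by simp
    then have "p = 1" "n dvd a - (b - i)"
      using p_pos inner_eq_iff[of 1 p a "b - i"] by simp_all
    then have "hub (a + i) = hub b"
      by (simp add: algebra_simps)
    then show ?thesis
      using b \<open>p = 1\<close> by metis
  qed
qed

text \<open>The ends 0 and \<open>i\<close> of the path are fixed, so the map on hubs is \<open>x \<mapsto> t x\<close> with \<open>t i = i\<close>. This
  excludes \<open>t = -1\<close>, the only other choice.\<close>

lemma rigid_single_inner:
  assumes unit: "i = 1 \<or> (i \<notin> Units (residue_ring n) \<and> j \<notin> Units (residue_ring n))"
    and p: "2 \<le> p" and H: "connection_units n i j = pm n 1"
  shows "rigid_set G {path_vertex 0 1}"
  unfolding rigid_set_def
proof (intro conjI ballI impI)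
  fix f assume f: "f \<in> automorphisms G" and "f ` {path_vertex 0 1} = {path_vertex 0 1}"
  then have "f (path_vertex 0 1) = path_vertex 0 1"
    by simp
  then have ends: "f (hub 0) = hub 0" "f (hub i) = hub i"
    using automorphism_fixing_inner[OF f, of 0] p by auto
  obtain b t where t: "sign_multiplier t" and affine: "\<And>x. f (hub x) = hub (b + t * x)"
    using automorphism_affine[OF unit f] by blast
  have b: "n dvd b" and ti: "n dvd b + t * i - i"
    using ends affine[of 0] affine[of i] by (simp_all add: dvd_diff_commute)
  have "n dvd t - 1"
  proof (rule ccontr)
    assume "\<not> n dvd t - 1"
    then have "n dvd t + 1"
      using H t connection_units_eq_pm_one_iff by blast
    then have "n dvd 2 * i"
      using b ti unfolding dvd_def by Groebner_Basis.algebra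
    then show False
      using not_dvd_2i by blast
  qed
  then show "f = id"
    using b affine_hub_map_id_iff[OF f affine] by simp
qed simp

text \<open>The two vertices cannot be exchanged, as only one of them is a hub. Fixing the hub 0 makes the map
  on hubs \<open>x \<mapsto> t x\<close>. If the ends \<open>-j\<close> and \<open>-j + i\<close> are fixed too, then \<open>t\<close> fixes the generators \<open>j\<close>
  and \<open>i\<close>, so \<open>t = 1\<close>. If they were exchanged, then \<open>-t j = -j + i\<close>, and \<open>t j = \<plusminus>j\<close> would give
  \<open>i = 0\<close> or \<open>i = 2 j\<close>, contrary to \<open>0 < i < 2 j \<le> n\<close>. The choice of \<open>-j\<close> matters here: at the hub \<open>j\<close>
  the same argument would fail for \<open>i + 2 j = n\<close>.\<close>

lemma rigid_hub_and_inner: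
  assumes unit: "i = 1 \<or> (i \<notin> Units (residue_ring n) \<and> j \<notin> Units (residue_ring n))"
  shows "rigid_set G {hub 0, path_vertex (- j) 1}"
  unfolding rigid_set_def
proof (intro conjI ballI impI)
  fix f assume f: "f \<in> automorphisms G"
    and W: "f ` {hub 0, path_vertex (- j) 1} = {hub 0, path_vertex (- j) 1}"
  have "f (hub 0) \<noteq> path_vertex (- j) 1"
    using automorphism_maps_hub[OF f, of 0] inner_neq_hub[of 1 "- j"] p_pos by force
  then have fixed: "f (hub 0) = hub 0" "f (path_vertex (- j) 1) = path_vertex (- j) 1"
    using W by (auto simp: doubleton_eq_iff)
  obtain b t where t: "sign_multiplier t" and affine: "\<And>x. f (hub x) = hub (b + t * x)"
    using automorphism_affine[OF unit f] by blast
  have b: "n dvd b"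
    using fixed(1) affine[of 0] by simp
  have "n dvd t - 1"
    using automorphism_fixing_inner[OF f fixed(2)]
  proof
    assume "f (hub (- j)) = hub (- j) \<and> f (hub (- j + i)) = hub (- j + i)"
    then have 1: "n dvd b + t * (- j) - (- j)" "n dvd b + t * (- j + i) - (- j + i)"
      using affine[of "- j"] affine[of "- j + i"] by (simp_all only: hub_eq_iff)
    obtain \<alpha> \<beta> where "n dvd 1 - \<alpha> * i - \<beta> * j"
      by (rule bezout)
    with 1 b show ?thesis
      unfolding dvd_def by Groebner_Basis.algebra
  next
    assume "p = 1 \<and> f (hub (- j)) = hub (- j + i)"
    then have swap: "n dvd b + t * (- j) - (- j + i)"
      using affine[of "- j"] by (simp only: hub_eq_iff)
    from t consider "n dvd t * j - j" | "n dvd t * j + j"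
      by (auto simp: sign_multiplier_def)
    then have False
    proof cases
      case 1
      then have "n dvd i"
        using swap b unfolding dvd_def by Groebner_Basis.algebra
      then show ?thesis
        using not_dvd_i by blast
    next
      case 2
      then have "n dvd 2 * j - i"
        using swap b unfolding dvd_def by Groebner_Basis.algebra
      then show ?thesis
        using not_dvd_small[of "2 * j - i"] i_pos i_less_j j_le_half by simp
    qed
    then show ?thesis ..
  qed
  then show "f = id"
    using b affine_hub_map_id_iff[OF f affine] by simp
qed simp

lemma Det_eq_card:
  assumes "rigid_set G W" "\<And>W'. determining_set G W' \<Longrightarrow> card W \<le> card W'"
  shows "Det G = card W"
  unfolding Det_def
  using assms rigid_set_imp_determining_set by (intro Least_equality) blast+

lemma Det_Dist_cost_of_smallest_rigid_set:
  assumes W: "rigid_set G W" and least: "\<And>W'. determining_set G W' \<Longrightarrow> card W \<le> card W'"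
  shows "Det G = card W \<and> Dist G = 2 \<and> cost G = card W"
proof -
  have "Det G = card W"
    using W least by (rule Det_eq_card)
  moreover have "0 < card W"
    using determining_set_nonempty rigid_set_imp_determining_set[OF W] by blast
  ultimately show ?thesis
    using Dist_cost_of_rigid_set[OF W] by simp
qed

end

theorem theorem23:
  fixes n i j :: int and p :: nat
  assumes "0 < i" and "i < j" and "real_of_int j \<le> real_of_int n / 2"
    and "gcd n (gcd i j) = 1"
    and "p \<ge> 1"
    and "i = 1 \<or> (i \<notin> Units (residue_ring n) \<and> j \<notin> Units (residue_ring n))"
  shows "(p \<ge> 2 \<and> connection_units n i j = pm n 1 \<longrightarrow>
            Det (subdivided_circulant n i p j) = 1 \<and>
            Dist (subdivided_circulant n i p j) = 2 \<and>
            cost (subdivided_circulant n i p j) = 1)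
       \<and> (\<not> (p \<ge> 2 \<and> connection_units n i j = pm n 1) \<longrightarrow>
            Det (subdivided_circulant n i p j) = 2 \<and>
            Dist (subdivided_circulant n i p j) = 2 \<and>
            cost (subdivided_circulant n i p j) = 2)"
proof -
  interpret circulant_parameters n i j p
    using assms(1-5) by unfold_locales linarith+
  show ?thesis
  proof (intro conjI impI)
    assume H: "p \<ge> 2 \<and> connection_units n i j = pm n 1"
    have "Det G = card {path_vertex 0 1} \<and> Dist G = 2 \<and> cost G = card {path_vertex 0 1}"
    proof (rule Det_Dist_cost_of_smallest_rigid_set)
      show "rigid_set G {path_vertex 0 1}"
        using rigid_single_inner[OF assms(6)] H by blast
      show "card {path_vertex 0 1} \<le> card W" if "determining_set G W" for W
        using determining_set_nonempty[OF that] by simp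
    qed
    then show "Det G = 1" "Dist G = 2" "cost G = 1"
      by simp_all
  next
    assume exc: "\<not> (p \<ge> 2 \<and> connection_units n i j = pm n 1)"
    have two: "card {hub 0, path_vertex (- j) 1} = 2"
      using inner_neq_hub[of 1 "- j" 0, symmetric] p_pos by (simp add: card_insert_if)
    have "Det G = card {hub 0, path_vertex (- j) 1} \<and> Dist G = 2
        \<and> cost G = card {hub 0, path_vertex (- j) 1}"
    proof (rule Det_Dist_cost_of_smallest_rigid_set)
      show "rigid_set G {hub 0, path_vertex (- j) 1}"
        using assms(6) by (rule rigid_hub_and_inner)
      show "card {hub 0, path_vertex (- j) 1} \<le> card W" if "determining_set G W" for W
        unfolding two using that exc by (rule determining_set_two_vertices)
    qed
    then show "Det G = 2" "Dist G = 2" "cost G = 2"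
      unfolding two by simp_all
  qed
qed

end
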